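(* Let $\theta_0=(\mathbf{A}_0,\mathbf{b}_0,\rho_{w,0})\in\Theta$ and let $\{\mathbf{X}(k)\}_{k\ge 0}$ be the BAR process (with positive correlations only) with true parameter $\theta_0$ and an arbitrary initial distribution $P_{\mathbf{X}(0)}$ on $\{0,1\}^p$ that does not depend on the parameter. For each $T\ge 1$ let $\hat{\theta}_T$ be a maximum likelihood estimator based on $\mathbf{X}(0),\dots,\mathbf{X}(T)$, i.e. $\hat{\theta}_T\in\arg\max_{\theta\in\Theta}L_T(\theta)$. Then $\hat{\theta}_T$ is strongly consistent: $\hat{\theta}_T\to\theta_0$ almost surely as $T\to\infty$.
   Context: Fix $p\in\mathbb{N}$, $p\ge 1$, and constants $b_{min}\in(0,1)$ and $0<\rho_{min}<\rho_{max}<1$. Parameter space: $\Theta$ is the set of triples $\theta=(\mathbf{A},\mathbf{b},\rho_w)$ with $\mathbf{A}=(a_{ij})\in\mathbb{R}^{p\times p}$, $\mathbf{b}\in\mathbb{R}^p$, $\rho_w\in\mathbb{R}^p$ such that for all $i,j\in\{1,\dots,p\}$: $a_{ij}\ge 0$, $\sum_{j=1}^p a_{ij}+b_i=1$, $b_i\ge b_{min}$, and $\rho_{w_i}\in[\rho_{min},\rho_{max}]$. The $i$-th row of $\mathbf{A}$ is denoted $\mathbf{a}_i^\top$. BAR model with positive correlations only, with parameter $\theta\in\Theta$: a Markov chain $\{\mathbf{X}(k)\}_{k\ge0}$ on $\{0,1\}^p$ with $\mathbf{X}(0)\sim P_{\mathbf{X}(0)}$ and $$X_i(k+1)\sim \mathrm{Ber}\left(\mathbf{a}_i^\top\mathbf{X}(k)+b_iW_i(k+1)\right),\quad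 i=1,\dots,p,$$ where $W_i(k+1)\sim\mathrm{Ber}(\rho_{w_i})$, $i=1,\dots,p$, are independent noise variables, independent of $\mathbf{X}(t)$ for all $t<k+1$, and the entries of $\mathbf{X}(k+1)$ are conditionally independent given $\mathbf{X}(k)$. Equivalently, its transition probabilities are, for $\mathbf{u},\mathbf{v}\in\{0,1\}^p$, $$p_{\mathbf{u}\mathbf{v}}(\theta)=\prod_{i=1}^p\left[\mathbf{a}_i^\top\mathbf{u}+\rho_{w_i}b_i\right]^{v_i}\left[1-\mathbf{a}_i^\top\mathbf{u}-\rho_{w_i}b_i\right]^{1-v_i}.$$ Rescaled log-likelihood of observations $\mathbf{x}(0),\dots,\mathbf{x}(T)$: $$L_T(\theta)=\frac1T\sum_{k=0}^{T-1}\log p_{\mathbf{x}(k)\mathbf{x}(k+1)}(\theta)+\frac1T\log P_{\mathbf{X}(0)}(\mathbf{x}(0)).$$ *)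

theory Defs
  imports "HOL-Probability.Probability"
begin

type_synonym 'p bar_param = "(real ^ 'p ^ 'p) \<times> (real ^ 'p) \<times> (real ^ 'p)"

definition bar_params :: "real \<Rightarrow> real \<Rightarrow> real \<Rightarrow> ('p::finite) bar_param set" where
  "bar_params b_min \<rho>_min \<rho>_max =
     {(A, b, \<rho>). (\<forall>i j. 0 \<le> A $ i $ j) \<and> (\<forall>i. (\<Sum>j\<in>UNIV. A $ i $ j) + b $ i = 1) \<and>
        (\<forall>i. b_min \<le> b $ i) \<and> (\<forall>i. \<rho>_min \<le> \<rho> $ i \<and> \<rho> $ i \<le> \<rho>_max)}"

text \<open>The state space \<open>{0,1}\<^sup>p\<close> is the type \<open>bool ^ 'p\<close>; arithmetic uses its embedding into real vectors.\<close>

definition real_state :: "bool ^ 'p \<Rightarrow> real ^ 'p::finite" where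
  "real_state u = (\<chi> i. of_bool (u $ i))"

fun bar_trans :: "('p::finite) bar_param \<Rightarrow> bool ^ 'p \<Rightarrow> bool ^ 'p \<Rightarrow> real" where
  "bar_trans (A, b, \<rho>) u v =
     (\<Prod>i\<in>UNIV. (A $ i \<bullet> real_state u + \<rho> $ i * b $ i) ^ of_bool (v $ i) *
               (1 - A $ i \<bullet> real_state u - \<rho> $ i * b $ i) ^ (1 - of_bool (v $ i)))"

text \<open>The Markov chain with initial law \<open>P0\<close> and transition probabilities \<open>bar_trans \<theta>\<close>.
  Conditioning on the whole past includes the Markov property.\<close>

locale bar_process = prob_space M
  for M :: "'w measure" +
  fixes \<theta> :: "('p::finite) bar_param"
    and P0 :: "(bool ^ 'p) pmf"
    and X :: "nat \<Rightarrow> 'w \<Rightarrow> bool ^ 'p"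
  assumes X_measurable: "X k \<in> measurable M (count_space UNIV)"
    and X_initial: "prob {\<omega> \<in> space M. X 0 \<omega> = x0} = pmf P0 x0"
    and X_transition:
      "prob {\<omega> \<in> space M. \<forall>t\<le>k. X t \<omega> = x t} \<noteq> 0 \<Longrightarrow>
       cond_prob M (\<lambda>\<omega>. X (Suc k) \<omega> = v) (\<lambda>\<omega>. \<forall>t\<le>k. X t \<omega> = x t) = bar_trans \<theta> (x k) v"

text \<open>The same model, driven by the noise variables \<open>W\<close>: given the past of \<open>X\<close> and
  \<open>W\<^sub>i(k+1)\<close>, the entry \<open>X\<^sub>i(k+1)\<close> is Bernoulli with parameter
  \<open>a\<^sub>i \<bullet> X(k) + b\<^sub>i W\<^sub>i(k+1)\<close>. The sublocale proof below derives the transition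
  probabilities from it.\<close>

locale bar_noise_process = prob_space M
  for M :: "'w measure" +
  fixes A :: "real ^ 'p::finite ^ 'p" and b \<rho> :: "real ^ 'p"
    and P0 :: "(bool ^ 'p) pmf"
    and X W :: "nat \<Rightarrow> 'w \<Rightarrow> bool ^ 'p"
  assumes \<rho>_unit: "0 \<le> \<rho> $ i" "\<rho> $ i \<le> 1"
    and X_measurable: "X k \<in> measurable M (count_space UNIV)"
    and X_initial: "prob {\<omega> \<in> space M. X 0 \<omega> = x0} = pmf P0 x0"
    and W_indep: "indep_vars (\<lambda>_. count_space UNIV) (\<lambda>(k, i) \<omega>. W k \<omega> $ i) ({1..} \<times> UNIV)"
    and W_law: "distr M (count_space UNIV) (\<lambda>\<omega>. W (Suc k) \<omega> $ i) = bernoulli_pmf (\<rho> $ i)"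
    and W_indep_past: "indep_event {\<omega> \<in> space M. W (Suc k) \<omega> \<in> S} {\<omega> \<in> space M. \<forall>t\<le>k. X t \<omega> = x t}"
    and X_entry:
      "prob {\<omega> \<in> space M. (\<forall>t\<le>k. X t \<omega> = x t) \<and> W (Suc k) \<omega> $ i = w} \<noteq> 0 \<Longrightarrow>
       cond_prob M (\<lambda>\<omega>. X (Suc k) \<omega> $ i)
         (\<lambda>\<omega>. (\<forall>t\<le>k. X t \<omega> = x t) \<and> W (Suc k) \<omega> $ i = w) =
       A $ i \<bullet> real_state (x k) + b $ i * of_bool w"
    and X_cond_indep:
      "prob {\<omega> \<in> space M. \<forall>t\<le>k. X t \<omega> = x t} \<noteq> 0 \<Longrightarrow>
       cond_prob M (\<lambda>\<omega>. X (Suc k) \<omega> = v) (\<lambda>\<omega>. \<forall>t\<le>k. X t \<omega> = x t) =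
       (\<Prod>i\<in>UNIV. cond_prob M (\<lambda>\<omega>. X (Suc k) \<omega> $ i = v $ i) (\<lambda>\<omega>. \<forall>t\<le>k. X t \<omega> = x t))"

sublocale bar_noise_process \<subseteq> bar_process M "(A, b, \<rho>)" P0 X
proof (unfold_locales, rule X_measurable, rule X_initial)
  fix k :: nat and x :: "nat \<Rightarrow> bool ^ 'p" and v :: "bool ^ 'p"
  let ?H = "\<lambda>\<omega>. \<forall>t\<le>k. X t \<omega> = x t"
  assume H: "prob {\<omega> \<in> space M. ?H \<omega>} \<noteq> 0"
  have [measurable]: "X t \<in> measurable M (count_space UNIV)" for t by (rule X_measurable)
  have W[measurable]: "W (Suc k) \<in> measurable M (count_space UNIV)"
  proof (rule measurableI)
    fix S :: "(bool ^ 'p) set"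
    have "{\<omega> \<in> space M. W (Suc k) \<omega> \<in> S} \<in> events"
      using W_indep_past[where S = S and k = k and x = x]
      unfolding indep_event_def indep_events_def by (auto simp: UNIV_bool)
    then show "W (Suc k) -` S \<inter> space M \<in> events"
      by (simp add: vimage_def Int_def conj_commute)
  qed simp
  have Hm[measurable]: "Measurable.pred M ?H" by measurable
  have Wi[measurable]: "Measurable.pred M (\<lambda>\<omega>. W (Suc k) \<omega> $ i = c)" for i c
    by (rule measurable_compose[OF W]) simp
  have Xi[measurable]: "Measurable.pred M (\<lambda>\<omega>. X (Suc k) \<omega> $ i)" for i
    by (rule measurable_compose[OF X_measurable]) simp
  have split2: "prob {\<omega> \<in> space M. P \<omega>} =
      prob {\<omega> \<in> space M. P \<omega> \<and> Q \<omega>} + prob {\<omega> \<in> space M. P \<omega> \<and> \<not> Q \<omega>}"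
    if [measurable]: "Measurable.pred M P" "Measurable.pred M Q" for P Q
    by (subst finite_measure_Union[symmetric]) (auto intro!: arg_cong[where f = prob])
  have noise: "prob {\<omega> \<in> space M. ?H \<omega> \<and> W (Suc k) \<omega> $ i = c} =
      pmf (bernoulli_pmf (\<rho> $ i)) c * prob {\<omega> \<in> space M. ?H \<omega>}" for i c
  proof -
    have "prob {\<omega> \<in> space M. ?H \<omega> \<and> W (Suc k) \<omega> $ i = c} =
        prob ({\<omega> \<in> space M. W (Suc k) \<omega> \<in> {w. w $ i = c}} \<inter> {\<omega> \<in> space M. ?H \<omega>})"
      by (intro arg_cong[where f = prob]) auto
    also have "\<dots> = prob {\<omega> \<in> space M. W (Suc k) \<omega> \<in> {w. w $ i = c}} * prob {\<omega> \<in> space M. ?H \<omega>}"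
    proof -
      have "indep_events (case_bool {\<omega> \<in> space M. W (Suc k) \<omega> \<in> {w. w $ i = c}} {\<omega> \<in> space M. ?H \<omega>}) UNIV"
        using W_indep_past unfolding indep_event_def .
      from conjunct2[OF iffD1[OF indep_events_def this], rule_format, of UNIV]
      show ?thesis by (simp add: UNIV_bool Int_commute mult.commute)
    qed
    also have "prob {\<omega> \<in> space M. W (Suc k) \<omega> \<in> {w. w $ i = c}} =
        measure (distr M (count_space UNIV) (\<lambda>\<omega>. W (Suc k) \<omega> $ i)) {c}"
      by (subst measure_distr) (auto intro!: arg_cong[where f = prob] measurable_compose[OF W])
    also have "\<dots> = pmf (bernoulli_pmf (\<rho> $ i)) c"
      unfolding W_law by (simp add: pmf.rep_eq)
    finally show ?thesis .
  qed
  let ?q = "\<lambda>i. A $ i \<bullet> real_state (x k) + \<rho> $ i * b $ i"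
  have entry: "prob {\<omega> \<in> space M. X (Suc k) \<omega> $ i \<and> ?H \<omega> \<and> W (Suc k) \<omega> $ i = c} =
      pmf (bernoulli_pmf (\<rho> $ i)) c * prob {\<omega> \<in> space M. ?H \<omega>} *
      (A $ i \<bullet> real_state (x k) + b $ i * of_bool c)" for i c
  proof (cases "prob {\<omega> \<in> space M. ?H \<omega> \<and> W (Suc k) \<omega> $ i = c} = 0")
    case True
    have "prob {\<omega> \<in> space M. X (Suc k) \<omega> $ i \<and> ?H \<omega> \<and> W (Suc k) \<omega> $ i = c} \<le>
        prob {\<omega> \<in> space M. ?H \<omega> \<and> W (Suc k) \<omega> $ i = c}"
      by (intro finite_measure_mono) auto
    then have "prob {\<omega> \<in> space M. X (Suc k) \<omega> $ i \<and> ?H \<omega> \<and> W (Suc k) \<omega> $ i = c} = 0"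
      unfolding True measure_le_0_iff by argo
    then show ?thesis unfolding noise[of i c, symmetric] True by argo
  next
    case False
    from X_entry[OF this] False show ?thesis
      unfolding noise[of i c, symmetric] by (simp add: cond_prob_def field_simps)
  qed
  have one: "prob {\<omega> \<in> space M. X (Suc k) \<omega> $ i \<and> ?H \<omega>} = ?q i * prob {\<omega> \<in> space M. ?H \<omega>}" for i
  proof -
    have "prob {\<omega> \<in> space M. X (Suc k) \<omega> $ i \<and> ?H \<omega>} =
        prob {\<omega> \<in> space M. X (Suc k) \<omega> $ i \<and> ?H \<omega> \<and> W (Suc k) \<omega> $ i = True} +
        prob {\<omega> \<in> space M. X (Suc k) \<omega> $ i \<and> ?H \<omega> \<and> W (Suc k) \<omega> $ i = False}"
      using split2[of "\<lambda>\<omega>. X (Suc k) \<omega> $ i \<and> ?H \<omega>" "\<lambda>\<omega>. W (Suc k) \<omega> $ i = True"]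
      by (simp add: conj_assoc)
    also have "\<dots> = ?q i * prob {\<omega> \<in> space M. ?H \<omega>}"
      unfolding entry using \<rho>_unit by (simp add: algebra_simps)
    finally show ?thesis .
  qed
  have "cond_prob M (\<lambda>\<omega>. X (Suc k) \<omega> $ i = c) ?H = ?q i ^ of_bool c * (1 - ?q i) ^ (1 - of_bool c)"
    for i c
  proof (cases c)
    case True
    then show ?thesis using one[of i] H by (simp add: cond_prob_def)
  next
    case False
    have "prob {\<omega> \<in> space M. ?H \<omega>} = prob {\<omega> \<in> space M. X (Suc k) \<omega> $ i \<and> ?H \<omega>} +
        prob {\<omega> \<in> space M. \<not> X (Suc k) \<omega> $ i \<and> ?H \<omega>}"
      using split2[of ?H "\<lambda>\<omega>. X (Suc k) \<omega> $ i"] by (simp add: conj_commute)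
    then have "prob {\<omega> \<in> space M. \<not> X (Suc k) \<omega> $ i \<and> ?H \<omega>} =
        (1 - ?q i) * prob {\<omega> \<in> space M. ?H \<omega>}"
      unfolding one by (simp add: algebra_simps)
    with False H show ?thesis by (simp add: cond_prob_def)
  qed
  then show "cond_prob M (\<lambda>\<omega>. X (Suc k) \<omega> = v) ?H = bar_trans (A, b, \<rho>) (x k) v"
    unfolding X_cond_indep[OF H] by (simp add: diff_diff_eq)
qed

text \<open>On \<open>bar_params\<close> every transition probability is positive. The convention \<open>ln 0 = 0\<close>
  only matters for the initial term, and only on the null event \<open>pmf P0 (x 0) = 0\<close>.\<close>

definition log_likelihood ::
  "(bool ^ 'p) pmf \<Rightarrow> nat \<Rightarrow> (nat \<Rightarrow> bool ^ 'p) \<Rightarrow> ('p::finite) bar_param \<Rightarrow> real" where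
  "log_likelihood P0 T x \<theta> =
     1 / real T * (\<Sum>k<T. ln (bar_trans \<theta> (x k) (x (Suc k)))) + 1 / real T * ln (pmf P0 (x 0))"

end

theory Submission
  imports Defs "HOL-Library.Discrete_Functions"
begin

text \<open>
  The centred transition indicators
  \<open>1{X\<^sub>k = u} (1{X\<^sub>k\<^sub>+\<^sub>1 = v} - p u v)\<close> are bounded and pairwise orthogonal, so their averages
  tend to \<open>0\<close> almost surely. Since all transition probabilities are bounded below by some \<open>c > 0\<close>,
  every state is visited with asymptotic frequency at least \<open>c\<close>; no ergodic theorem is needed.
  Up to an error that vanishes uniformly in the parameter, the log-likelihood ratio of \<open>\<theta>\<close> and
  \<open>\<theta>\<^sub>0\<close> is then a weighted sum, with weights bounded away from \<open>0\<close>, of the negative relative entropies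
  between the rows of their transition matrices. At a maximiser it is nonnegative, so these
  entropies, and with them the Hellinger distances between the rows, tend to \<open>0\<close>. Hence the
  transition probabilities of the estimator converge; their one-coordinate marginals at the state
  \<open>0\<close> and at the unit vectors determine the parameter continuously, since \<open>b\<^sub>i\<close> stays positive.
\<close>

section \<open>Strong law for bounded orthogonal variables\<close>

text \<open>Expanding the square of a sum with one more term, the mixed terms have expectation 0 and
  the new square contributes at most \<open>B\<^sup>2\<close>.\<close>

lemma (in prob_space) orthogonal_sum_second_moment:
  fixes D :: "nat \<Rightarrow> 'a \<Rightarrow> real"
  assumes [measurable]: "\<And>k. D k \<in> borel_measurable M"
    and bound: "\<And>k \<omega>. \<bar>D k \<omega>\<bar> \<le> B"
    and orth: "\<And>j k. j < k \<Longrightarrow> expectation (\<lambda>\<omega>. D j \<omega> * D k \<omega>) = 0"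
  shows "expectation (\<lambda>\<omega>. (\<Sum>k<n. D k \<omega>)\<^sup>2) \<le> real n * B\<^sup>2"
proof (induction n)
  case (Suc n)
  have B: "0 \<le> B" using bound[of 0 undefined] by linarith
  have Db: "\<bar>D j \<omega> * D k \<omega>\<bar> \<le> B * B" for j k \<omega>
    unfolding abs_mult by (intro mult_mono bound B) auto
  have Di[simp]: "integrable M (\<lambda>\<omega>. D j \<omega> * D k \<omega>)" for j k
    by (rule integrable_const_bound[where B = "B * B"]) (use Db in auto)
  have "expectation (\<lambda>\<omega>. (\<Sum>k<Suc n. D k \<omega>)\<^sup>2) =
      expectation (\<lambda>\<omega>. (\<Sum>k<n. D k \<omega>)\<^sup>2 + 2 * (\<Sum>k<n. D k \<omega> * D n \<omega>) + D n \<omega> * D n \<omega>)"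
    unfolding sum_distrib_right[symmetric] by (simp add: power2_eq_square algebra_simps)
  also have "\<dots> = expectation (\<lambda>\<omega>. (\<Sum>k<n. D k \<omega>)\<^sup>2) +
      2 * (\<Sum>k<n. expectation (\<lambda>\<omega>. D k \<omega> * D n \<omega>)) + expectation (\<lambda>\<omega>. D n \<omega> * D n \<omega>)"
    by (simp add: power2_eq_square sum_product)
  also have "\<dots> \<le> real n * B\<^sup>2 + 0 + B * B"
  proof (intro add_mono Suc)
    show "2 * (\<Sum>k<n. expectation (\<lambda>\<omega>. D k \<omega> * D n \<omega>)) \<le> 0"
      using orth by simp
    show "expectation (\<lambda>\<omega>. D n \<omega> * D n \<omega>) \<le> B * B"
      using integral_mono[of M "\<lambda>\<omega>. D n \<omega> * D n \<omega>" "\<lambda>_. B * B"] abs_le_D1[OF Db]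
      by (simp add: prob_space)
  qed
  finally show ?case by (simp add: algebra_simps power2_eq_square)
qed simp

text \<open>Along the squares, the averages have second moments at most
  \<open>B\<^sup>2 / n\<^sup>2\<close>, which is summable. Hence the series of squared averages has
  finite expectation, converges almost surely, and its terms tend to 0.\<close>

lemma (in prob_space) orthogonal_average_squares:
  fixes D :: "nat \<Rightarrow> 'a \<Rightarrow> real"
  assumes [measurable]: "\<And>k. D k \<in> borel_measurable M"
    and bound: "\<And>k \<omega>. \<bar>D k \<omega>\<bar> \<le> B"
    and orth: "\<And>j k. j < k \<Longrightarrow> expectation (\<lambda>\<omega>. D j \<omega> * D k \<omega>) = 0"
  shows "AE \<omega> in M. (\<lambda>n. (\<Sum>k<n\<^sup>2. D k \<omega>) / real (n\<^sup>2)) \<longlonglongrightarrow> 0"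
proof -
  let ?Y = "\<lambda>n \<omega>. ((\<Sum>k<n\<^sup>2. D k \<omega>) / real (n\<^sup>2))\<^sup>2"
  have B: "0 \<le> B" using bound[of 0 undefined] by linarith
  have Sb: "\<bar>\<Sum>k<n. D k \<omega>\<bar> \<le> real n * B" for n \<omega>
    using sum_abs[of "\<lambda>k. D k \<omega>" "{..<n}"] sum_bounded_above[of "{..<n}" "\<lambda>k. \<bar>D k \<omega>\<bar>" B] bound
    by (force intro: order_trans)
  have Si: "integrable M (\<lambda>\<omega>. (\<Sum>k<n. D k \<omega>)\<^sup>2)" for n
    by (rule integrable_const_bound[where B = "(real n * B)\<^sup>2"])
       (use power_mono[OF Sb abs_ge_zero, of _ n 2] in auto)
  \<comment> \<open>At \<open>n = 0\<close> both sides are 0, because division by 0 yields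
    0.\<close>
  have "nn_integral M (\<lambda>\<omega>. ennreal (?Y n \<omega>)) \<le> ennreal (B\<^sup>2 * inverse ((real n)\<^sup>2))" for n
  proof -
    have "nn_integral M (\<lambda>\<omega>. ennreal (?Y n \<omega>)) = ennreal (expectation (?Y n))"
      by (rule nn_integral_eq_integral) (auto simp: power_divide Si)
    also have "expectation (?Y n) = expectation (\<lambda>\<omega>. (\<Sum>k<n\<^sup>2. D k \<omega>)\<^sup>2) / (real (n\<^sup>2))\<^sup>2"
      by (simp add: power_divide)
    also have "\<dots> \<le> (real (n\<^sup>2) * B\<^sup>2) / (real (n\<^sup>2))\<^sup>2"
      by (intro divide_right_mono orthogonal_sum_second_moment assms) auto
    also have "\<dots> = B\<^sup>2 * inverse ((real n)\<^sup>2)"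
      by (simp add: power2_eq_square field_simps)
    finally show ?thesis by (simp add: ennreal_leI)
  qed
  then have "(\<Sum>n. nn_integral M (\<lambda>\<omega>. ennreal (?Y n \<omega>))) \<le> (\<Sum>n. ennreal (B\<^sup>2 * inverse ((real n)\<^sup>2)))"
    by (intro suminf_le) auto
  also have "\<dots> < \<infinity>"
    using inverse_power_summable[of 2, where 'a = real]
    by (subst suminf_ennreal2) (auto intro!: summable_mult)
  finally have "nn_integral M (\<lambda>\<omega>. \<Sum>n. ennreal (?Y n \<omega>)) \<noteq> \<infinity>"
    by (subst nn_integral_suminf) auto
  then have "AE \<omega> in M. (\<Sum>n. ennreal (?Y n \<omega>)) \<noteq> \<infinity>"
    by (intro nn_integral_PInf_AE) auto
  then show ?thesis
  proof eventually_elim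
    case (elim \<omega>)
    then have "summable (\<lambda>n. ?Y n \<omega>)"
      by (intro summable_suminf_not_top) auto
    then have "(\<lambda>n. ?Y n \<omega>) \<longlonglongrightarrow> 0" by (rule summable_LIMSEQ_zero)
    from tendsto_real_sqrt[OF this]
    have "(\<lambda>n. \<bar>(\<Sum>k<n\<^sup>2. D k \<omega>) / real (n\<^sup>2)\<bar>) \<longlonglongrightarrow> 0"
      by (simp only: real_sqrt_abs real_sqrt_zero)
    then show ?case by (rule tendsto_rabs_zero_cancel)
  qed
qed

text \<open>If \<open>m\<^sup>2\<close> is the largest square up to \<open>n\<close>, at most
  \<open>2 * m\<close> summands lie beyond it. They change the average by at most
  \<open>2 * B / m\<close>, which vanishes as \<open>n\<close> grows.\<close>

lemma average_tendsto_0_of_squares: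
  fixes d :: "nat \<Rightarrow> real"
  assumes bound: "\<And>k. \<bar>d k\<bar> \<le> B"
    and lim: "(\<lambda>n. (\<Sum>k<n\<^sup>2. d k) / real (n\<^sup>2)) \<longlonglongrightarrow> 0"
  shows "(\<lambda>n. (\<Sum>k<n. d k) / real n) \<longlonglongrightarrow> 0"
proof -
  let ?r = floor_sqrt
  let ?g = "\<lambda>n. \<bar>(\<Sum>k<n\<^sup>2. d k) / real (n\<^sup>2)\<bar> + 2 * B / real n"
  have B: "0 \<le> B" using bound[of 0] by linarith
  have "?g \<longlonglongrightarrow> 0 + 0"
    by (intro tendsto_add tendsto_rabs_zero lim lim_const_over_n)
  moreover have "filterlim ?r at_top sequentially"
  proof (subst filterlim_at_top, intro allI eventually_sequentiallyI)
    fix z n :: nat assume "z\<^sup>2 \<le> n"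
    then show "z \<le> ?r n" using le_floor_sqrt_iff by blast
  qed
  ultimately have g: "(\<lambda>n. ?g (?r n)) \<longlonglongrightarrow> 0"
    by (auto dest: filterlim_compose)
  show ?thesis
  proof (rule Lim_null_comparison[OF _ g], rule eventually_sequentiallyI)
    fix n :: nat assume n: "1 \<le> n"
    define m where "m = ?r n"
    have m: "1 \<le> m" using n le_floor_sqrt_iff[of 1 n] by (simp add: m_def)
    have mn: "m\<^sup>2 \<le> n" by (simp add: m_def)
    have "n < (Suc m)\<^sup>2" by (simp add: m_def Suc_floor_sqrt_power2_gt)
    then have nm: "n - m\<^sup>2 \<le> 2 * m" by (simp add: power2_eq_square)
    have "(\<Sum>k<n. d k) = (\<Sum>k<m\<^sup>2. d k) + (\<Sum>k=m\<^sup>2..<n. d k)"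
      using sum.atLeastLessThan_concat[of 0 "m\<^sup>2" n d] mn by (simp add: atLeast0LessThan)
    moreover have "\<bar>\<Sum>k=m\<^sup>2..<n. d k\<bar> \<le> real (n - m\<^sup>2) * B"
      using sum_abs[of d "{m\<^sup>2..<n}"] sum_bounded_above[of "{m\<^sup>2..<n}" "\<lambda>k. \<bar>d k\<bar>" B] bound
      by (force intro: order_trans)
    moreover have "real (n - m\<^sup>2) * B \<le> real (2 * m) * B"
      by (intro mult_right_mono of_nat_mono nm B)
    ultimately have "\<bar>\<Sum>k<n. d k\<bar> \<le> \<bar>\<Sum>k<m\<^sup>2. d k\<bar> + 2 * m * B" by simp
    then have "\<bar>\<Sum>k<n. d k\<bar> / real n \<le> (\<bar>\<Sum>k<m\<^sup>2. d k\<bar> + 2 * m * B) / real (m\<^sup>2)"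
      by (intro frac_le of_nat_mono mn) (use B m in auto)
    also have "\<dots> = ?g m" using m by (simp add: field_simps power2_eq_square)
    finally show "norm ((\<Sum>k<n. d k) / real n) \<le> ?g (?r n)" by (simp add: m_def)
  qed
qed

theorem (in prob_space) orthogonal_strong_law:
  fixes D :: "nat \<Rightarrow> 'a \<Rightarrow> real"
  assumes "\<And>k. D k \<in> borel_measurable M"
    and bound: "\<And>k \<omega>. \<bar>D k \<omega>\<bar> \<le> B"
    and "\<And>j k. j < k \<Longrightarrow> expectation (\<lambda>\<omega>. D j \<omega> * D k \<omega>) = 0"
  shows "AE \<omega> in M. (\<lambda>n. (\<Sum>k<n. D k \<omega>) / real n) \<longlonglongrightarrow> 0"
  using orthogonal_average_squares[OF assms]
  by (rule AE_mp) (auto intro!: AE_I2 average_tendsto_0_of_squares[OF bound])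

section \<open>Orthogonality of the centred transition indicators\<close>

text \<open>The martingale difference property, by summation over the finitely many histories up to
  time \<open>k\<close>: as \<open>Suc j \<le> k\<close>, the earlier increment is a function of the
  history, while the later one has mean 0 on each history.\<close>

lemma (in prob_space) transition_increments_orthogonal:
  fixes X :: "nat \<Rightarrow> 'a \<Rightarrow> 's::finite" and P :: "'s \<Rightarrow> 's \<Rightarrow> real"
  assumes X[measurable]: "\<And>k. X k \<in> measurable M (count_space UNIV)"
    and step: "\<And>k x v. prob {\<omega> \<in> space M. X (Suc k) \<omega> = v \<and> (\<forall>t\<le>k. X t \<omega> = x t)} =
        prob {\<omega> \<in> space M. \<forall>t\<le>k. X t \<omega> = x t} * P (x k) v"
    and "j < k"
  defines "D \<equiv> \<lambda>u v k \<omega>. of_bool (X k \<omega> = u) * (of_bool (X (Suc k) \<omega> = v) - P u v)"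
  shows "expectation (\<lambda>\<omega>. D u v j \<omega> * D u v k \<omega>) = 0"
proof -
  \<comment> \<open>Taking the histories extensional makes \<open>H\<close> finite and lets each
    path agree with exactly one element of \<open>H\<close>, so the sum in \<open>pt\<close> has a
    single surviving term.\<close>
  define H where "H = {..k} \<rightarrow>\<^sub>E (UNIV :: 's set)"
  define d where "d = (\<lambda>x :: nat \<Rightarrow> 's. of_bool (x j = u) * (of_bool (x (Suc j) = v) - P u v))"
  have fin: "finite H" unfolding H_def by (intro finite_PiE) auto
  have pt: "D u v j \<omega> * D u v k \<omega> =
      (\<Sum>x\<in>H. d x * of_bool (x k = u) *
        (indicator {\<omega> \<in> space M. X (Suc k) \<omega> = v \<and> (\<forall>t\<le>k. X t \<omega> = x t)} \<omega> -
         indicator {\<omega> \<in> space M. \<forall>t\<le>k. X t \<omega> = x t} \<omega> * P u v))" (is "_ = (\<Sum>x\<in>H. ?f x)")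
    if \<omega>: "\<omega> \<in> space M" for \<omega>
  proof -
    let ?x = "restrict (\<lambda>t. X t \<omega>) {..k}"
    have "?f x = 0" if "x \<in> H - {?x}" for x
    proof -
      have "\<exists>t\<le>k. X t \<omega> \<noteq> x t"
        using that by (auto simp: H_def PiE_eq_iff fun_eq_iff extensional_def PiE_def split: if_splits)
      then show ?thesis by (auto simp: indicator_def)
    qed
    then have "(\<Sum>x\<in>H. ?f x) = (\<Sum>x\<in>{?x}. ?f x)"
      by (intro sum.mono_neutral_right fin) (auto simp: H_def)
    also have "\<dots> = D u v j \<omega> * D u v k \<omega>"
      using \<open>j < k\<close> \<omega> by (simp add: D_def d_def indicator_def)
    finally show ?thesis ..
  qed
  have m: "{\<omega> \<in> space M. X (Suc k) \<omega> = v \<and> (\<forall>t\<le>k. X t \<omega> = x t)} \<in> events"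
      "{\<omega> \<in> space M. \<forall>t\<le>k. X t \<omega> = x t} \<in> events" for x
    by measurable
  have "expectation (\<lambda>\<omega>. D u v j \<omega> * D u v k \<omega>) =
      (\<Sum>x\<in>H. d x * of_bool (x k = u) *
        (prob {\<omega> \<in> space M. X (Suc k) \<omega> = v \<and> (\<forall>t\<le>k. X t \<omega> = x t)} -
         prob {\<omega> \<in> space M. \<forall>t\<le>k. X t \<omega> = x t} * P u v))"
    using m by (subst Bochner_Integration.integral_cong[OF refl pt])
      (simp_all add: emeasure_eq_measure less_top[symmetric])
  also have "\<dots> = 0" unfolding step by (intro sum.neutral) auto
  finally show ?thesis .
qed

section \<open>From likelihood domination to convergence of transition probabilities\<close>

lemma ln_le_two_sqrt: "ln x \<le> 2 * (sqrt x - 1)" if "0 < x" for x :: real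
  using ln_le_minus_one[of "sqrt x"] that by (simp add: ln_sqrt)

text \<open>Bounding the logarithm through the square root of \<open>q v / p v\<close> gives,
  termwise, \<open>2 * (sqrt (p v) * sqrt (q v) - p v)\<close>, which is \<open>q v - p v\<close>
  minus the squared difference of the roots. The masses cancel in the sum.\<close>

lemma hellinger_le_relative_entropy:
  fixes p q :: "'s::finite \<Rightarrow> real"
  assumes p: "\<And>v. 0 < p v" "(\<Sum>v\<in>UNIV. p v) = 1"
    and q: "\<And>v. 0 < q v" "(\<Sum>v\<in>UNIV. q v) = 1"
  shows "(\<Sum>v\<in>UNIV. p v * (ln (q v) - ln (p v))) \<le> - (\<Sum>v\<in>UNIV. (sqrt (p v) - sqrt (q v))\<^sup>2)"
proof -
  have "p v * (ln (q v) - ln (p v)) \<le> q v - p v - (sqrt (p v) - sqrt (q v))\<^sup>2" for v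
  proof -
    have "p v * (ln (q v) - ln (p v)) \<le> p v * (2 * (sqrt (q v / p v) - 1))"
      using p(1)[of v] q(1)[of v] ln_le_two_sqrt[of "q v / p v"] by (simp add: ln_div)
    also have "p v * sqrt (q v / p v) = sqrt (p v) * sqrt (q v)"
      using p(1)[of v] q(1)[of v]
      by (smt (verit) nonzero_mult_div_cancel_left real_sqrt_divide real_sqrt_gt_zero real_sqrt_mult_self
          times_divide_eq_right mult.assoc abs_of_pos)
    then have "p v * (2 * (sqrt (q v / p v) - 1)) = q v - p v - (sqrt (p v) - sqrt (q v))\<^sup>2"
      using p(1)[of v] q(1)[of v] by (simp add: power2_diff algebra_simps)
    finally show ?thesis .
  qed
  then have "(\<Sum>v\<in>UNIV. p v * (ln (q v) - ln (p v))) \<le>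
      (\<Sum>v\<in>UNIV. q v - p v - (sqrt (p v) - sqrt (q v))\<^sup>2)"
    by (intro sum_mono)
  then show ?thesis using p(2) q(2) by (simp add: sum_subtractf)
qed

text \<open>The deterministic core, for one fixed path \<open>x\<close>: at each \<open>n\<close>,
  the kernel \<open>Q n\<close> has at least the likelihood of the true kernel \<open>P\<close>. The
  entropy loss of \<open>Q n\<close>, weighted by visit frequencies, is then at most a vanishing
  fluctuation, while each weight is eventually above \<open>c / 2\<close>.\<close>

lemma likelihood_domination_imp_transitions_tendsto:
  fixes x :: "nat \<Rightarrow> 's::finite" and P :: "'s \<Rightarrow> 's \<Rightarrow> real" and Q :: "nat \<Rightarrow> 's \<Rightarrow> 's \<Rightarrow> real"
  assumes c: "0 < c" and P: "\<And>u v. c \<le> P u v" "\<And>u. (\<Sum>v\<in>UNIV. P u v) = 1"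
    and Q: "\<And>n u v. 1 \<le> n \<Longrightarrow> c \<le> Q n u v" "\<And>n u. 1 \<le> n \<Longrightarrow> (\<Sum>v\<in>UNIV. Q n u v) = 1"
    and freq: "\<And>u v. (\<lambda>n. (\<Sum>k<n. of_bool (x k = u) * (of_bool (x (Suc k) = v) - P u v)) / real n)
        \<longlonglongrightarrow> 0"
    and dom: "\<And>n. 1 \<le> n \<Longrightarrow> (\<Sum>k<n. ln (P (x k) (x (Suc k)))) \<le> (\<Sum>k<n. ln (Q n (x k) (x (Suc k))))"
  shows "(\<lambda>n. Q n u v) \<longlonglongrightarrow> P u v"
proof -
  define E where "E u v n = (\<Sum>k<n. of_bool (x k = u) * (of_bool (x (Suc k) = v) - P u v)) / real n" for u v n
  define N where "N u n = (\<Sum>k<n. of_bool (x k = u) :: real) / real n" for u n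
  define h where "h u n = (\<Sum>v\<in>UNIV. (sqrt (P u v) - sqrt (Q n u v))\<^sup>2)" for u n
  \<comment> \<open>All entries lie between \<open>c\<close> and 1, so \<open>B\<close> bounds every
    difference of their logarithms.\<close>
  define B where "B = - ln c"
  have P1: "P u v \<le> 1" for u v
    using member_le_sum[of v UNIV "P u"] P c by (simp add: less_imp_le order_trans[of 0 c])
  have Q1: "Q n u v \<le> 1" if "1 \<le> n" for n u v
    using member_le_sum[of v UNIV "Q n u"] Q[OF that] c by (simp add: less_imp_le order_trans[of 0 c])
  have E0: "E u v \<longlonglongrightarrow> 0" for u v using freq[of u v] unfolding E_def[abs_def] .
  have pos: "0 < P u v" "1 \<le> n \<Longrightarrow> 0 < Q n u v" for n u v
    using P(1) Q(1) c by (auto intro: less_le_trans)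
  have ell: "\<bar>ln (Q n u v) - ln (P u v)\<bar> \<le> B" if n: "1 \<le> n" for n u v
  proof -
    have "ln c \<le> ln (Q n u v)" "ln c \<le> ln (P u v)" "ln (Q n u v) \<le> 0" "ln (P u v) \<le> 0"
      using P(1) Q(1)[OF n] c P1 Q1[OF n] pos(1) pos(2)[OF n] by auto
    then show ?thesis unfolding B_def by linarith
  qed
  \<comment> \<open>Summing \<open>E w u n\<close> over the previous state \<open>w\<close> compares
    the arrivals in \<open>u\<close> with the average of \<open>P (x k) u\<close>, which is at least
    \<open>c\<close>. Arrivals are counted at times 1 to \<open>n\<close>, visits at times 0 to
    \<open>n - 1\<close>; this shift costs at most \<open>1 / n\<close>.\<close>
  have visits: "\<forall>\<^sub>F n in sequentially. c / 2 < N u n" for u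
  proof -
    have "(\<lambda>n. c - \<bar>\<Sum>w\<in>UNIV. E w u n\<bar> - 1 / real n) \<longlonglongrightarrow> c - \<bar>\<Sum>w\<in>(UNIV::'s set). 0\<bar> - 0"
      by (intro tendsto_intros E0 lim_const_over_n)
    then have "\<forall>\<^sub>F n in sequentially. c / 2 < c - \<bar>\<Sum>w\<in>UNIV. E w u n\<bar> - 1 / real n"
      by (rule order_tendstoD) (use c in simp)
    then show ?thesis
      using eventually_ge_at_top[of 1]
    proof eventually_elim
      case (elim n)
      have "(\<Sum>w\<in>UNIV. E w u n) = (\<Sum>k<n. of_bool (x (Suc k) = u) - P (x k) u) / real n"
        unfolding E_def sum_divide_distrib[symmetric]
        by (subst sum.swap) (simp add: of_bool_def if_distrib[where f = "\<lambda>a. a * _"] cong: if_cong)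
      also have "\<dots> \<le> (\<Sum>k<n. of_bool (x (Suc k) = u) - c) / real n"
        by (intro divide_right_mono sum_mono diff_mono P) auto
      also have "(\<Sum>k<n. of_bool (x (Suc k) = u)) \<le> (\<Sum>k<Suc n. of_bool (x k = u) :: real)"
        by (subst sum.lessThan_Suc_shift) simp
      then have "(\<Sum>k<n. of_bool (x (Suc k) = u) - c) / real n \<le>
          ((\<Sum>k<n. of_bool (x k = u)) + 1 - real n * c) / real n"
        by (intro divide_right_mono) (auto simp: sum_subtractf intro: order_trans)
      also have "\<dots> = N u n + 1 / real n - c"
        using elim by (simp add: N_def field_simps)
      finally show ?case using elim by linarith
    qed
  qed
  \<comment> \<open>The sum bounds the fluctuation of the log-likelihood ratio; the factor
    \<open>2 / c\<close> comes from dividing by the visit frequency.\<close>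
  define R where "R n = 2 / c * (\<Sum>u\<in>UNIV. \<Sum>v\<in>UNIV. \<bar>E u v n\<bar> * B)" for n
  have R0: "R \<longlonglongrightarrow> 0"
  proof -
    have "R \<longlonglongrightarrow> 2 / c * (\<Sum>u\<in>(UNIV::'s set). \<Sum>v\<in>(UNIV::'s set). \<bar>0\<bar> * B)"
      unfolding R_def[abs_def] by (intro tendsto_intros E0)
    then show ?thesis by simp
  qed
  have N0: "0 \<le> N u n" for u n by (simp add: N_def sum_nonneg)
  \<comment> \<open>The empirical frequency of the transition from \<open>u\<close> to
    \<open>v\<close>, split into its fluctuation and its compensator.\<close>
  have EN: "E u v n + N u n * P u v =
      (\<Sum>k<n. of_bool (x k = u) * of_bool (x (Suc k) = v)) / real n" for u v n
    by (simp only: E_def N_def right_diff_distrib sum_subtractf diff_divide_distrib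
        sum_distrib_right[symmetric]) simp
  have h0: "0 \<le> h u n" for u n by (simp add: h_def sum_nonneg)
  \<comment> \<open>The log-likelihood ratio is nonnegative and splits according to
    \<open>EN\<close>. The fluctuation part is bounded by \<open>B\<close>, the compensator part by
    minus the Hellinger terms.\<close>
  have key: "(\<Sum>u\<in>UNIV. N u n * h u n) \<le> (\<Sum>u\<in>UNIV. \<Sum>v\<in>UNIV. \<bar>E u v n\<bar> * B)" if n: "1 \<le> n" for n
  proof -
    let ?l = "\<lambda>u v. ln (Q n u v) - ln (P u v)"
    have "0 \<le> (\<Sum>k<n. ?l (x k) (x (Suc k))) / real n"
      using dom[OF n] by (simp add: sum_subtractf)
    also have "(\<Sum>k<n. ?l (x k) (x (Suc k))) =
        (\<Sum>k<n. \<Sum>u\<in>UNIV. of_bool (x k = u) * (\<Sum>v\<in>UNIV. of_bool (x (Suc k) = v) * ?l u v))"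
      by (simp add: of_bool_def if_distrib[where f = "\<lambda>a. a * _"] cong: if_cong)
    also have "\<dots> = (\<Sum>k<n. \<Sum>u\<in>UNIV. \<Sum>v\<in>UNIV. of_bool (x k = u) * of_bool (x (Suc k) = v) * ?l u v)"
      by (simp only: sum_distrib_left mult.assoc)
    also have "\<dots> = (\<Sum>u\<in>UNIV. \<Sum>v\<in>UNIV. (\<Sum>k<n. of_bool (x k = u) * of_bool (x (Suc k) = v)) * ?l u v)"
      unfolding sum_distrib_right
      by (subst sum.swap, rule sum.cong[OF refl], rule sum.swap)
    also have "\<dots> / real n = (\<Sum>u\<in>UNIV. \<Sum>v\<in>UNIV. (E u v n + N u n * P u v) * ?l u v)"
      by (simp only: EN times_divide_eq_left sum_divide_distrib[symmetric])
    also have "\<dots> = (\<Sum>u\<in>UNIV. \<Sum>v\<in>UNIV. E u v n * ?l u v) + (\<Sum>u\<in>UNIV. N u n * (\<Sum>v\<in>UNIV. P u v * ?l u v))"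
      by (simp add: distrib_right sum.distrib sum_distrib_left mult.assoc)
    also have "\<dots> \<le> (\<Sum>u\<in>UNIV. \<Sum>v\<in>UNIV. \<bar>E u v n\<bar> * B) + (\<Sum>u\<in>UNIV. N u n * (- h u n))"
    proof (intro add_mono sum_mono mult_left_mono N0)
      fix u v
      have "E u v n * ?l u v \<le> \<bar>E u v n\<bar> * \<bar>?l u v\<bar>" by (metis abs_ge_self abs_mult)
      also have "\<dots> \<le> \<bar>E u v n\<bar> * B" by (intro mult_left_mono ell[OF n]) auto
      finally show "E u v n * ?l u v \<le> \<bar>E u v n\<bar> * B" .
      show "(\<Sum>v\<in>UNIV. P u v * ?l u v) \<le> - h u n"
        unfolding h_def by (intro hellinger_le_relative_entropy pos n P Q)
    qed
    finally show ?thesis by (simp add: sum_negf)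
  qed
  have "\<forall>\<^sub>F n in sequentially. norm (h u n) \<le> R n"
    using visits[of u] eventually_ge_at_top[of 1]
  proof eventually_elim
    case (elim n)
    have "c / 2 * h u n \<le> N u n * h u n" using elim h0 by (intro mult_right_mono) auto
    also have "\<dots> \<le> (\<Sum>u\<in>UNIV. N u n * h u n)"
      by (intro member_le_sum) (auto simp: N0 h0)
    also note key[OF elim(2)]
    finally show ?case using c h0[of u n] by (simp add: R_def field_simps)
  qed
  from Lim_null_comparison[OF this R0] have hl: "h u \<longlonglongrightarrow> 0" .
  have "(\<lambda>n. (sqrt (P u v) - sqrt (Q n u v))\<^sup>2) \<longlonglongrightarrow> 0"
  proof (rule Lim_null_comparison[OF _ hl], rule always_eventually, rule allI)
    fix n
    show "norm ((sqrt (P u v) - sqrt (Q n u v))\<^sup>2) \<le> h u n"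
      unfolding h_def using member_le_sum[of v UNIV "\<lambda>v. (sqrt (P u v) - sqrt (Q n u v))\<^sup>2"] by simp
  qed
  from tendsto_real_sqrt[OF this] have "(\<lambda>n. sqrt (P u v) - sqrt (Q n u v)) \<longlonglongrightarrow> 0"
    by (simp add: tendsto_rabs_zero_iff)
  from tendsto_diff[OF tendsto_const[of "sqrt (P u v)"] this]
  have "(\<lambda>n. sqrt (Q n u v)) \<longlonglongrightarrow> sqrt (P u v)" by simp
  from tendsto_power[OF this, of 2]
  have "(\<lambda>n. (sqrt (Q n u v))\<^sup>2) \<longlonglongrightarrow> P u v" using pos(1)[of u v] by simp
  \<comment> \<open>Squaring undoes the root only where \<open>Q n u v\<close> is known to be
    nonnegative, that is for \<open>n \<ge> 1\<close>.\<close>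
  then show ?thesis
    by (rule Lim_transform_eventually)
       (use pos(2) in \<open>auto intro!: eventually_sequentiallyI[of 1] simp: less_imp_le\<close>)
qed

section \<open>The BAR transition kernel: marginals and uniform bounds\<close>

lemma sum_prod_bool_vec:
  fixes f :: "'p::finite \<Rightarrow> bool \<Rightarrow> 'a::comm_semiring_1"
  shows "(\<Sum>v\<in>UNIV. \<Prod>i\<in>UNIV. f i ((v :: bool ^ 'p) $ i)) = (\<Prod>i\<in>UNIV. f i True + f i False)"
proof -
  have "(\<Prod>i\<in>UNIV. f i True + f i False) = (\<Prod>i\<in>UNIV. \<Sum>c\<in>UNIV. f i c)"
    by (simp add: UNIV_bool add.commute)
  also have "\<dots> = (\<Sum>g\<in>UNIV \<rightarrow>\<^sub>E UNIV. \<Prod>i\<in>UNIV. f i (g i))"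
    by (rule prod_sum_PiE) auto
  also have "\<dots> = (\<Sum>v\<in>UNIV. \<Prod>i\<in>UNIV. f i ((v :: bool ^ 'p) $ i))"
    by (rule sum.reindex_bij_witness[of _ "\<lambda>v. ($) v" vec_lambda]) auto
  finally show ?thesis ..
qed

text \<open>The conditional probability that coordinate \<open>i\<close> is 1 after one step from
  \<open>u\<close>, with the noise averaged out.\<close>

fun bar_entry :: "('p::finite) bar_param \<Rightarrow> bool ^ 'p \<Rightarrow> 'p \<Rightarrow> real" where
  "bar_entry (A, b, \<rho>) u i = A $ i \<bullet> real_state u + \<rho> $ i * b $ i"

lemma bar_trans_eq_prod_entry:
  "bar_trans \<theta> u v = (\<Prod>i\<in>UNIV. if v $ i then bar_entry \<theta> u i else 1 - bar_entry \<theta> u i)"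
  by (cases \<theta>) (auto intro!: prod.cong)

lemma sum_bar_trans: "(\<Sum>v\<in>UNIV. bar_trans \<theta> u v) = 1"
  unfolding bar_trans_eq_prod_entry
  by (subst sum_prod_bool_vec[of "\<lambda>i c. if c then bar_entry \<theta> u i else 1 - bar_entry \<theta> u i"]) simp

lemma marginal_bar_trans: "(\<Sum>v | v $ i. bar_trans \<theta> u v) = bar_entry \<theta> u i"
proof -
  \<comment> \<open>Replacing the factor for \<open>False\<close> at coordinate \<open>i\<close> by
    0 encodes the constraint \<open>v $ i\<close>, so the sum may run over all states and
    factorises; each other coordinate then contributes 1.\<close>
  let ?f = "\<lambda>j c. if c then bar_entry \<theta> u j else if j = i then 0 else 1 - bar_entry \<theta> u j"
  have "(\<Sum>v | v $ i. bar_trans \<theta> u v) = (\<Sum>v\<in>UNIV. \<Prod>j\<in>UNIV. ?f j (v $ j))"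
  proof (rule sum.mono_neutral_cong_left)
    show "\<forall>v\<in>UNIV - {v. v $ i}. (\<Prod>j\<in>UNIV. ?f j (v $ j)) = 0"
      by (auto intro!: prod_zero exI[of _ i])
  qed (auto simp: bar_trans_eq_prod_entry intro!: prod.cong)
  also have "\<dots> = (\<Prod>j\<in>UNIV. ?f j True + ?f j False)"
    by (rule sum_prod_bool_vec)
  also have "\<dots> = (\<Prod>j\<in>UNIV. if j = i then bar_entry \<theta> u j else 1)"
    by (intro prod.cong) auto
  finally show ?thesis by simp
qed

text \<open>The inner product lies between 0 and \<open>1 - b $ i\<close>, so the noise leaves mass
  at least \<open>\<rho> $ i * b $ i\<close> for the value 1 and at least
  \<open>(1 - \<rho> $ i) * b $ i\<close> for the value 0.\<close>

lemma bar_entry_bounds: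
  assumes \<theta>: "\<theta> \<in> bar_params b_min \<rho>_min \<rho>_max"
    and "0 < b_min" "0 < \<rho>_min" "\<rho>_max < 1"
  shows "\<rho>_min * b_min \<le> bar_entry \<theta> u i" "bar_entry \<theta> u i \<le> 1 - (1 - \<rho>_max) * b_min"
proof -
  obtain A b \<rho> where eq: "\<theta> = (A, b, \<rho>)" by (cases \<theta>)
  have A: "0 \<le> A $ i $ j" and row: "(\<Sum>j\<in>UNIV. A $ i $ j) = 1 - b $ i" and b: "b_min \<le> b $ i"
    and \<rho>: "\<rho>_min \<le> \<rho> $ i" "\<rho> $ i \<le> \<rho>_max" for j
    using \<theta> by (auto simp: eq bar_params_def algebra_simps)
  have in01: "0 \<le> A $ i \<bullet> real_state u" "A $ i \<bullet> real_state u \<le> 1 - b $ i"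
    unfolding row[symmetric] inner_vec_def real_state_def using A
    by (auto intro!: sum_nonneg sum_mono2)
  have "\<rho>_min * b_min \<le> \<rho> $ i * b $ i" using assms b \<rho> by (intro mult_mono) auto
  then show "\<rho>_min * b_min \<le> bar_entry \<theta> u i" using in01 by (simp add: eq)
  have "(1 - \<rho>_max) * b_min \<le> (1 - \<rho> $ i) * b $ i" using assms b \<rho> by (intro mult_mono) auto
  then show "bar_entry \<theta> u i \<le> 1 - (1 - \<rho>_max) * b_min"
    using in01 by (simp add: eq algebra_simps)
qed

lemma bar_trans_lower_bound:
  assumes "0 < b_min" "0 < \<rho>_min" "\<rho>_max < 1"
  obtains c where "0 < c"
    and "\<And>\<theta> u v. \<theta> \<in> bar_params b_min \<rho>_min \<rho>_max \<Longrightarrow> c \<le> bar_trans (\<theta> :: ('p::finite) bar_param) u v"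
proof
  let ?m = "min (\<rho>_min * b_min) ((1 - \<rho>_max) * b_min)"
  show "0 < (\<Prod>i\<in>(UNIV::'p set). ?m)" using assms by (intro prod_pos) auto
  fix \<theta> :: "'p bar_param" and u v
  assume "\<theta> \<in> bar_params b_min \<rho>_min \<rho>_max"
  note bd = bar_entry_bounds[OF this assms, of u]
  show "(\<Prod>i\<in>(UNIV::'p set). ?m) \<le> bar_trans \<theta> u v"
    unfolding bar_trans_eq_prod_entry
  proof (intro prod_mono conjI)
    fix i
    show "0 \<le> ?m" using assms by auto
    show "?m \<le> (if v $ i then bar_entry \<theta> u i else 1 - bar_entry \<theta> u i)"
      using bd[of i] by auto
  qed
qed

section \<open>Recovering the parameter from the kernel\<close>

text \<open>The zero state isolates \<open>\<rho> $ i * b $ i\<close>, and the \<open>j\<close>-th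
  unit vector adds \<open>A $ i $ j\<close>. The row sum then yields \<open>b $ i\<close>, which is
  positive and can be divided out.\<close>

lemma bar_param_from_entries:
  assumes \<theta>: "(A, b, \<rho>) \<in> bar_params b_min \<rho>_min \<rho>_max" and "0 < b_min"
  defines "e \<equiv> bar_entry (A, b, \<rho>)"
  shows "A $ i $ j = e (\<chi> l. l = j) i - e (\<chi> l. False) i" (is ?A)
    and "b $ i = 1 - (\<Sum>j\<in>UNIV. e (\<chi> l. l = j) i - e (\<chi> l. False) i)" (is ?b)
    and "\<rho> $ i = e (\<chi> l. False) i / b $ i"
proof -
  have "real_state (\<chi> l. l = j) = axis j 1" for j :: 'a
    by (simp add: vec_eq_iff real_state_def axis_def)
  moreover have "real_state (\<chi> l. False) = (0 :: real ^ 'a)"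
    by (simp add: vec_eq_iff real_state_def)
  ultimately have A: "A $ i $ j = e (\<chi> l. l = j) i - e (\<chi> l. False) i"
    and e0: "e (\<chi> l. False) i = \<rho> $ i * b $ i" for j
    by (simp_all add: e_def inner_axis)
  show ?A by (rule A)
  show ?b using \<theta> unfolding A[symmetric] by (simp add: bar_params_def algebra_simps)
  have "b_min \<le> b $ i" using \<theta> by (simp add: bar_params_def)
  then show "\<rho> $ i = e (\<chi> l. False) i / b $ i" using \<open>0 < b_min\<close> by (simp add: e0)
qed

text \<open>Entries are finite sums of transition probabilities, hence converge; the recovery
  formulas are continuous in them because the limit \<open>b0 $ i\<close> is positive.\<close>

lemma bar_param_tendsto:
  fixes \<theta> :: "nat \<Rightarrow> ('p::finite) bar_param"
  assumes \<theta>: "\<And>n. 1 \<le> n \<Longrightarrow> \<theta> n \<in> bar_params b_min \<rho>_min \<rho>_max"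
    and \<theta>0: "\<theta>0 \<in> bar_params b_min \<rho>_min \<rho>_max" and b_min: "0 < b_min"
    and lim: "\<And>u v. (\<lambda>n. bar_trans (\<theta> n) u v) \<longlonglongrightarrow> bar_trans \<theta>0 u v"
  shows "\<theta> \<longlonglongrightarrow> \<theta>0"
proof -
  define A b \<rho> where "A n = fst (\<theta> n)" and "b n = fst (snd (\<theta> n))" and "\<rho> n = snd (snd (\<theta> n))" for n
  obtain A0 b0 \<rho>0 where eq0: "\<theta>0 = (A0, b0, \<rho>0)" by (cases \<theta>0)
  have eq: "\<theta> n = (A n, b n, \<rho> n)" for n by (simp add: A_def b_def \<rho>_def)
  note p0 = bar_param_from_entries[OF \<theta>0[unfolded eq0] b_min, folded eq0]
  note p = bar_param_from_entries[OF \<theta>[unfolded eq] b_min, folded eq]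
  have e: "(\<lambda>n. bar_entry (\<theta> n) u i) \<longlonglongrightarrow> bar_entry \<theta>0 u i" for u i
    unfolding marginal_bar_trans[symmetric] by (intro tendsto_sum lim)
  have ev: "(\<lambda>n. f n) \<longlonglongrightarrow> l" if "g \<longlonglongrightarrow> l" "\<And>n. 1 \<le> n \<Longrightarrow> f n = g n" for f g :: "nat \<Rightarrow> real" and l
    using that(1) by (rule Lim_transform_eventually) (auto intro!: eventually_sequentiallyI[of 1] simp: that(2))
  have A: "A \<longlonglongrightarrow> A0"
  proof (intro vec_tendstoI)
    fix i j
    show "(\<lambda>n. A n $ i $ j) \<longlonglongrightarrow> A0 $ i $ j"
      unfolding p0(1)[of i j] by (rule ev[OF _ p(1)]) (intro tendsto_intros e)
  qed
  have b: "(\<lambda>n. b n $ i) \<longlonglongrightarrow> b0 $ i" for i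
    unfolding p0(2)[of i] by (rule ev[OF _ p(2)]) (intro tendsto_intros e)
  have "0 < b0 $ i" for i using \<theta>0 b_min by (auto simp: eq0 bar_params_def intro: less_le_trans)
  then have \<rho>: "(\<lambda>n. \<rho> n $ i) \<longlonglongrightarrow> \<rho>0 $ i" for i
    unfolding p0(3)[of i] by (intro ev[OF _ p(3)] tendsto_intros e b) (simp add: less_imp_neq[symmetric])
  show ?thesis
    unfolding eq0 eq[abs_def] by (intro tendsto_Pair A vec_tendstoI[OF b] vec_tendstoI[OF \<rho>])
qed

section \<open>Strong consistency\<close>

theorem theorem1:
  fixes M :: "'w measure"
    and \<theta>0 :: "('p::finite) bar_param"
    and P0 :: "(bool ^ 'p) pmf"
    and X :: "nat \<Rightarrow> 'w \<Rightarrow> bool ^ 'p"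
    and \<theta>_hat :: "nat \<Rightarrow> 'w \<Rightarrow> 'p bar_param"
    and b_min \<rho>_min \<rho>_max :: real
  assumes "0 < b_min" "b_min < 1"
    and "0 < \<rho>_min" "\<rho>_min < \<rho>_max" "\<rho>_max < 1"
    and "\<theta>0 \<in> bar_params b_min \<rho>_min \<rho>_max"
    and "bar_process M \<theta>0 P0 X"
    and "\<And>T. T \<ge> 1 \<Longrightarrow> AE \<omega> in M.
           is_arg_max (log_likelihood P0 T (\<lambda>k. X k \<omega>))
             (\<lambda>\<theta>. \<theta> \<in> bar_params b_min \<rho>_min \<rho>_max) (\<theta>_hat T \<omega>)"
  shows "AE \<omega> in M. (\<lambda>T. \<theta>_hat T \<omega>) \<longlonglongrightarrow> \<theta>0"
proof -
  interpret bar_process M \<theta>0 P0 X by fact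
  obtain c where c: "0 < c"
    and lower: "\<And>\<theta> u v. \<theta> \<in> bar_params b_min \<rho>_min \<rho>_max \<Longrightarrow> c \<le> bar_trans (\<theta> :: 'p bar_param) u v"
    using bar_trans_lower_bound assms(1,3,5) by metis
  define D where "D = (\<lambda>u v k \<omega>. of_bool (X k \<omega> = u) * (of_bool (X (Suc k) \<omega> = v) - bar_trans \<theta>0 u v))"
  note X_measurable[measurable]
  \<comment> \<open>Multiplying out the conditional probability extends the transition law to
    histories of probability 0, where both sides vanish.\<close>
  have step: "prob {\<omega> \<in> space M. X (Suc k) \<omega> = v \<and> (\<forall>t\<le>k. X t \<omega> = x t)} =
      prob {\<omega> \<in> space M. \<forall>t\<le>k. X t \<omega> = x t} * bar_trans \<theta>0 (x k) v" for k x v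
  proof (cases "prob {\<omega> \<in> space M. \<forall>t\<le>k. X t \<omega> = x t} = 0")
    case True
    have "prob {\<omega> \<in> space M. X (Suc k) \<omega> = v \<and> (\<forall>t\<le>k. X t \<omega> = x t)} \<le>
        prob {\<omega> \<in> space M. \<forall>t\<le>k. X t \<omega> = x t}"
      by (intro finite_measure_mono) auto
    with True show ?thesis by (simp add: measure_le_0_iff)
  next
    case False
    with X_transition[OF this, of v] show ?thesis by (simp add: cond_prob_def field_simps)
  qed
  have "AE \<omega> in M. (\<lambda>n. (\<Sum>k<n. D u v k \<omega>) / real n) \<longlonglongrightarrow> 0" for u v
  proof (rule orthogonal_strong_law)
    show "D u v k \<in> borel_measurable M" for k unfolding D_def by measurable
    show "\<bar>D u v k \<omega>\<bar> \<le> 1 + \<bar>bar_trans \<theta>0 u v\<bar>" for k \<omega>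
      by (auto simp: D_def of_bool_def)
    show "expectation (\<lambda>\<omega>. D u v j \<omega> * D u v k \<omega>) = 0" if "j < k" for j k
      unfolding D_def by (rule transition_increments_orthogonal[OF X_measurable step that])
  qed
  then have freq: "AE \<omega> in M. \<forall>u v. (\<lambda>n. (\<Sum>k<n. D u v k \<omega>) / real n) \<longlonglongrightarrow> 0"
    by (simp add: AE_all_countable)
  \<comment> \<open>There are only countably many \<open>T\<close>, so one null set serves all of
    them and the rest of the argument is pathwise.\<close>
  have "AE \<omega> in M. \<forall>T. T \<ge> 1 \<longrightarrow> is_arg_max (log_likelihood P0 T (\<lambda>k. X k \<omega>))
      (\<lambda>\<theta>. \<theta> \<in> bar_params b_min \<rho>_min \<rho>_max) (\<theta>_hat T \<omega>)"
    unfolding AE_all_countable using assms(8) by (auto intro: AE_impI)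
  with freq show ?thesis
  proof eventually_elim
    case (elim \<omega>)
    have hat: "\<theta>_hat T \<omega> \<in> bar_params b_min \<rho>_min \<rho>_max" if "1 \<le> T" for T
      using elim(2) that by (auto simp: is_arg_max_def)
    show ?case
    proof (rule bar_param_tendsto[OF hat assms(6,1)])
      show "(\<lambda>T. bar_trans (\<theta>_hat T \<omega>) u v) \<longlonglongrightarrow> bar_trans \<theta>0 u v" for u v
      proof (rule likelihood_domination_imp_transitions_tendsto[OF c, where x = "\<lambda>k. X k \<omega>"])
        show "(\<Sum>k<n. ln (bar_trans \<theta>0 (X k \<omega>) (X (Suc k) \<omega>)))
            \<le> (\<Sum>k<n. ln (bar_trans (\<theta>_hat n \<omega>) (X k \<omega>) (X (Suc k) \<omega>)))" if n: "1 \<le> n" for n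
        proof -
          \<comment> \<open>The true parameter is itself a competitor in the maximisation. The
            initial term is the same on both sides and cancels, whatever value \<open>ln\<close>
            takes there.\<close>
          have "log_likelihood P0 n (\<lambda>k. X k \<omega>) \<theta>0 \<le> log_likelihood P0 n (\<lambda>k. X k \<omega>) (\<theta>_hat n \<omega>)"
            using elim(2) n assms(6) unfolding is_arg_max_def by (meson not_less)
          with n show ?thesis by (simp add: log_likelihood_def divide_le_cancel)
        qed
      qed (use lower hat assms(6) elim(1) in \<open>auto simp: sum_bar_trans D_def\<close>)
    qed
  qed
qed

end
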